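(* Let $(P,\cdot,\{~,~\})$ be a Poisson algebra over a field $\mathbf{k}$ of characteristic $0$, let $(V,\mu,\rho)$ be a representation of it, and let $0\to V\xrightarrow{i}E\xrightarrow{p}P\to 0$ be an abelian extension of $P$ by the representation $(V,\mu,\rho)$. Then there is an exact sequence $$1\to\mathrm{Aut}_{V,P}(E)\xrightarrow{\iota}\mathrm{Aut}_V(E)\xrightarrow{\tau}\mathcal{C}_{\mu,\rho}\xrightarrow{\mathcal{W}}H^2_{\mathrm{FGV}}(P,V),$$ where $\mathrm{Aut}_{V,P}(E)=\{\gamma\in\mathrm{Aut}_V(E)\mid\tau(\gamma)=(\mathrm{id}_V,\mathrm{id}_P)\}$ and $\iota$ is the inclusion.
   Context: A Poisson algebra $(P,\cdot,\{~,~\})$ is a commutative associative algebra $(P,\cdot)$ that is also a Lie algebra $(P,\{~,~\})$, with $\{x,y\cdot z\}=\{x,y\}\cdot z+y\cdot\{x,z\}$. A representation $(V,\mu,\rho)$ of it is a vector space $V$ with linear maps $\mu,\rho:P\to\mathrm{End}(V)$ such that for all $x,y\in P$: $\mu_{x\cdot y}=\mu_x\mu_y$, $\rho_{\{x,y\}}=\rho_x\rho_y-\rho_y\rho_x$, $\mu_{\{x,y\}}=\rho_x\mu_y-\mu_y\rho_x$, $\rho_{x\cdot y}=\mu_x\rho_y+\mu_y\rho_x$. An abelian extension of $P$ by $(V,\mu,\rho)$ is a short exact sequence of Poisson algebras $0\to V\xrightarrow{i}E\xrightarrow{p}P\to0$, where $V$ carries the trivial (zero) product and bracket, such that, identifying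 $V$ with $i(V)\subset E$, one has $\mu_xv=s(x)\cdot_Ev$ and $\rho_xv=\{s(x),v\}_E$ for $x\in P$, $v\in V$ and any linear section $s:P\to E$ of $p$ (i.e. $ps=\mathrm{id}_P$). $\mathrm{Aut}$ denotes the group of Poisson algebra automorphisms; since $V$ has trivial structure, $\mathrm{Aut}(V)$ is the group of linear automorphisms of $V$. $\mathrm{Aut}_V(E)$ is the group of Poisson algebra automorphisms $\gamma$ of $E$ with $\gamma(V)=V$. The group homomorphism $\tau:\mathrm{Aut}_V(E)\to\mathrm{Aut}(V)\times\mathrm{Aut}(P)$ is $\tau(\gamma)=(\gamma|_V,\overline\gamma)$, where $\overline\gamma=p\gamma s$ for any linear section $s$ (independent of $s$). $\mathcal{C}_{\mu,\rho}$ is the subgroup of all $(\beta,\alpha)\in\mathrm{Aut}(V)\times\mathrm{Aut}(P)$ such that $\beta(\mu_xv)=\mu_{\alpha(x)}\beta(v)$ and $\beta(\rho_xv)=\rho_{\alpha(x)}\beta(v)$ for all $x\in P$, $v\in V$; the image of $\tau$ lies in $\mathcal{C}_{\mu,\rho}$. Second (Flato-Gerstenhaber-Voronov) Poisson cohomology $H^2_{\mathrm{FGV}}(P,V)$: a Poisson $2$-cocycle is a pair $(h,H)$ with $h:P\times P\to V$ symmetric bilinear and $H:P\times P\to V$ skew-symmetric bilinear, satisfying for all $x,y,z\in P$ (1) $\mu_xh(y,z)-h(x\cdot y,z)+h(x,y\cdot z)-\mu_zh(x,y)=0$; (2) $\rho_xH(y,z)+\rho_yH(z,x)+\rho_zH(x,y)+H(x,\{y,z\})+H(y,\{z,x\})+H(z,\{x,y\})=0$;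 (3) $\rho_xh(y,z)-h(\{x,y\},z)-h(y,\{x,z\})+H(x,y\cdot z)-\mu_yH(x,z)-\mu_zH(x,y)=0$. Two $2$-cocycles $(h,H)$, $(h',H')$ are cohomologous if there is a linear map $\varphi:P\to V$ with $h(x,y)-h'(x,y)=\mu_x\varphi(y)-\varphi(x\cdot y)+\mu_y\varphi(x)$ and $H(x,y)-H'(x,y)=\rho_x\varphi(y)-\varphi(\{x,y\})-\rho_y\varphi(x)$. $H^2_{\mathrm{FGV}}(P,V)$ is the vector space of $2$-cocycles modulo this relation. Wells map: choose a linear section $s$ of $p$ and put $h(x,y)=s(x)\cdot_Es(y)-s(x\cdot y)$, $H(x,y)=\{s(x),s(y)\}_E-s(\{x,y\})$; $(h,H)$ is a Poisson $2$-cocycle. For $(\beta,\alpha)\in\mathcal{C}_{\mu,\rho}$ set $h_{(\beta,\alpha)}(x,y)=\beta(h(\alpha^{-1}(x),\alpha^{-1}(y)))$ and $H_{(\beta,\alpha)}(x,y)=\beta(H(\alpha^{-1}(x),\alpha^{-1}(y)))$; this is again a $2$-cocycle. Define $\mathcal{W}:\mathcal{C}_{\mu,\rho}\to H^2_{\mathrm{FGV}}(P,V)$ by $\mathcal{W}(\beta,\alpha)=[(h_{(\beta,\alpha)},H_{(\beta,\alpha)})-(h,H)]$; it does not depend on the choice of $s$. The map $\mathcal{W}$ is only a map of sets (not necessarily a homomorphism); exactness at $\mathcal{C}_{\mu,\rho}$ means $\mathrm{im}(\tau)=\{(\beta,\alpha)\in\mathcal{C}_{\mu,\rho}\mid\mathcal{W}(\beta,\alpha)=0\}$.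 *)

theory Defs
  imports Complex_Main "HOL-Algebra.Coset" "HOL-Algebra.Module"
    "HOL-Library.Function_Algebras" "HOL-Library.Product_Plus"
begin

text \<open>All vector spaces live on whole types, as in \<^theory>\<open>HOL.Vector_Spaces\<close>: the additive group is
  the type class structure, the scalar multiplication is explicit.\<close>

record ('k, 'a) poisson =
  smul :: "'k \<Rightarrow> 'a \<Rightarrow> 'a"
  prd :: "'a \<Rightarrow> 'a \<Rightarrow> 'a"  (infixl \<open>\<bullet>\<index>\<close> 70)
  brk :: "'a \<Rightarrow> 'a \<Rightarrow> 'a"  (\<open>\<lbrace>_,/ _\<rbrace>\<index>\<close>)

definition bilinear_map ::
  "('k::field \<Rightarrow> 'a::ab_group_add \<Rightarrow> 'a) \<Rightarrow> ('k \<Rightarrow> 'b::ab_group_add \<Rightarrow> 'b)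
    \<Rightarrow> ('k \<Rightarrow> 'c::ab_group_add \<Rightarrow> 'c) \<Rightarrow> ('a \<Rightarrow> 'b \<Rightarrow> 'c) \<Rightarrow> bool" where
  "bilinear_map s1 s2 s3 f \<longleftrightarrow>
     (\<forall>x. Vector_Spaces.linear s2 s3 (\<lambda>y. f x y)) \<and> (\<forall>y. Vector_Spaces.linear s1 s3 (\<lambda>x. f x y))"

locale poisson_algebra =
  fixes P :: "('k::field, 'p::ab_group_add) poisson" (structure)
  assumes vector_space: "vector_space (smul P)"
    and bilinear_prd: "bilinear_map (smul P) (smul P) (smul P) (prd P)"
    and prd_assoc: "(x \<bullet> y) \<bullet> z = x \<bullet> (y \<bullet> z)"
    and prd_commute: "x \<bullet> y = y \<bullet> x"
    and bilinear_brk: "bilinear_map (smul P) (smul P) (smul P) (brk P)"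
    and brk_alternating: "\<lbrace>x, x\<rbrace> = 0"
    and jacobi: "\<lbrace>x, \<lbrace>y, z\<rbrace>\<rbrace> + \<lbrace>y, \<lbrace>z, x\<rbrace>\<rbrace> + \<lbrace>z, \<lbrace>x, y\<rbrace>\<rbrace> = 0"
    and leibniz: "\<lbrace>x, y \<bullet> z\<rbrace> = \<lbrace>x, y\<rbrace> \<bullet> z + y \<bullet> \<lbrace>x, z\<rbrace>"

text \<open>A linear map \<open>\<mu> : P \<rightarrow> End(V)\<close> is rendered as a bilinear map \<open>P \<times> V \<rightarrow> V\<close>, likewise \<open>\<rho>\<close>.\<close>

locale poisson_representation =
  fixes P :: "('k::field, 'p::ab_group_add) poisson" (structure)
    and sV :: "'k \<Rightarrow> 'v::ab_group_add \<Rightarrow> 'v"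
    and \<mu> \<rho> :: "'p \<Rightarrow> 'v \<Rightarrow> 'v"
  assumes vector_space: "vector_space sV"
    and bilinear_\<mu>: "bilinear_map (smul P) sV sV \<mu>"
    and bilinear_\<rho>: "bilinear_map (smul P) sV sV \<rho>"
    and \<mu>_prd: "\<mu> (x \<bullet> y) v = \<mu> x (\<mu> y v)"
    and \<rho>_brk: "\<rho> \<lbrace>x, y\<rbrace> v = \<rho> x (\<rho> y v) - \<rho> y (\<rho> x v)"
    and \<mu>_brk: "\<mu> \<lbrace>x, y\<rbrace> v = \<rho> x (\<mu> y v) - \<mu> y (\<rho> x v)"
    and \<rho>_prd: "\<rho> (x \<bullet> y) v = \<mu> x (\<rho> y v) + \<mu> y (\<rho> x v)"

definition poisson_hom ::
  "('k::field, 'a::ab_group_add) poisson \<Rightarrow> ('k, 'b::ab_group_add) poisson \<Rightarrow> ('a \<Rightarrow> 'b) \<Rightarrow> bool" where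
  "poisson_hom A B f \<longleftrightarrow>
     Vector_Spaces.linear (smul A) (smul B) f \<and>
     (\<forall>x y. f (x \<bullet>\<^bsub>A\<^esub> y) = f x \<bullet>\<^bsub>B\<^esub> f y) \<and>
     (\<forall>x y. f \<lbrace>x, y\<rbrace>\<^bsub>A\<^esub> = \<lbrace>f x, f y\<rbrace>\<^bsub>B\<^esub>)"

definition trivial_poisson :: "('k \<Rightarrow> 'v \<Rightarrow> 'v) \<Rightarrow> ('k, 'v::ab_group_add) poisson" where
  "trivial_poisson sV = \<lparr>smul = sV, prd = (\<lambda>_ _. 0), brk = (\<lambda>_ _. 0)\<rparr>"

definition poisson_Aut :: "('k::field, 'a::ab_group_add) poisson \<Rightarrow> ('a \<Rightarrow> 'a) monoid" where
  "poisson_Aut A = \<lparr>carrier = {f. poisson_hom A A f \<and> bij f}, mult = (\<circ>), one = id\<rparr>"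

definition linear_section ::
  "('k::field, 'p::ab_group_add) poisson \<Rightarrow> ('k, 'e::ab_group_add) poisson
    \<Rightarrow> ('e \<Rightarrow> 'p) \<Rightarrow> ('p \<Rightarrow> 'e) \<Rightarrow> bool" where
  "linear_section P E p s \<longleftrightarrow> Vector_Spaces.linear (smul P) (smul E) s \<and> p \<circ> s = id"

locale abelian_extension =
  fixes P :: "('k::field, 'p::ab_group_add) poisson"
    and sV :: "'k \<Rightarrow> 'v::ab_group_add \<Rightarrow> 'v"
    and \<mu> \<rho> :: "'p \<Rightarrow> 'v \<Rightarrow> 'v"
    and E :: "('k, 'e::ab_group_add) poisson"
    and i :: "'v \<Rightarrow> 'e"
    and p :: "'e \<Rightarrow> 'p"
  assumes poisson_E: "poisson_algebra E"
    and hom_i: "poisson_hom (trivial_poisson sV) E i"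
    and hom_p: "poisson_hom E P p"
    and inj_i: "inj i"
    and exact: "range i = {e. p e = 0}"
    and surj_p: "surj p"
    and \<mu>_section: "linear_section P E p s \<Longrightarrow> i (\<mu> x v) = s x \<bullet>\<^bsub>E\<^esub> i v"
    and \<rho>_section: "linear_section P E p s \<Longrightarrow> i (\<rho> x v) = \<lbrace>s x, i v\<rbrace>\<^bsub>E\<^esub>"

lemma (in abelian_extension) linear_section_exists: "\<exists>s. linear_section P E p s"
proof -
  have lin: "Vector_Spaces.linear (smul E) (smul P) p"
    using hom_p by (simp add: poisson_hom_def)
  then interpret L: vector_space_pair "smul E" "smul P"
    by (simp add: vector_space_pair_def Vector_Spaces.linear_def)
  show ?thesis
    using L.linear_surjective_right_inverse[OF lin surj_p] by (auto simp: linear_section_def)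
qed

definition Aut_V :: "('k::field, 'e::ab_group_add) poisson \<Rightarrow> ('v \<Rightarrow> 'e) \<Rightarrow> ('e \<Rightarrow> 'e) monoid" where
  "Aut_V E i = (poisson_Aut E)\<lparr>carrier := {\<gamma> \<in> carrier (poisson_Aut E). \<gamma> ` range i = range i}\<rparr>"

text \<open>Under the identification of \<open>V\<close> with \<open>range i\<close>, the restriction of \<open>\<gamma>\<close> to \<open>V\<close> is
  \<open>i\<inverse> \<circ> \<gamma> \<circ> i\<close>.\<close>

definition tau ::
  "('v \<Rightarrow> 'e) \<Rightarrow> ('e \<Rightarrow> 'p) \<Rightarrow> ('p \<Rightarrow> 'e) \<Rightarrow> ('e \<Rightarrow> 'e) \<Rightarrow> ('v \<Rightarrow> 'v) \<times> ('p \<Rightarrow> 'p)" where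
  "tau i p s \<gamma> = (the_inv i \<circ> \<gamma> \<circ> i, p \<circ> \<gamma> \<circ> s)"

definition Aut_VP ::
  "('k::field, 'e::ab_group_add) poisson \<Rightarrow> ('v \<Rightarrow> 'e) \<Rightarrow> ('e \<Rightarrow> 'p) \<Rightarrow> ('p \<Rightarrow> 'e) \<Rightarrow> ('e \<Rightarrow> 'e) monoid" where
  "Aut_VP E i p s = (Aut_V E i)\<lparr>carrier := {\<gamma> \<in> carrier (Aut_V E i). tau i p s \<gamma> = (id, id)}\<rparr>"

definition compatible_pairs ::
  "('k::field, 'p::ab_group_add) poisson \<Rightarrow> ('k \<Rightarrow> 'v::ab_group_add \<Rightarrow> 'v)
    \<Rightarrow> ('p \<Rightarrow> 'v \<Rightarrow> 'v) \<Rightarrow> ('p \<Rightarrow> 'v \<Rightarrow> 'v) \<Rightarrow> (('v \<Rightarrow> 'v) \<times> ('p \<Rightarrow> 'p)) monoid" where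
  "compatible_pairs P sV \<mu> \<rho> =
     (poisson_Aut (trivial_poisson sV) \<times>\<times> poisson_Aut P)\<lparr>carrier :=
       {(\<beta>, \<alpha>) \<in> carrier (poisson_Aut (trivial_poisson sV) \<times>\<times> poisson_Aut P).
          (\<forall>x v. \<beta> (\<mu> x v) = \<mu> (\<alpha> x) (\<beta> v)) \<and> (\<forall>x v. \<beta> (\<rho> x v) = \<rho> (\<alpha> x) (\<beta> v))}\<rparr>"

type_synonym ('p, 'v) cochain2 = "('p \<Rightarrow> 'p \<Rightarrow> 'v) \<times> ('p \<Rightarrow> 'p \<Rightarrow> 'v)"

definition cocycles2 ::
  "('k::field, 'p::ab_group_add) poisson \<Rightarrow> ('k \<Rightarrow> 'v::ab_group_add \<Rightarrow> 'v)
    \<Rightarrow> ('p \<Rightarrow> 'v \<Rightarrow> 'v) \<Rightarrow> ('p \<Rightarrow> 'v \<Rightarrow> 'v) \<Rightarrow> ('p, 'v) cochain2 set" where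
  "cocycles2 P sV \<mu> \<rho> = {(h, H).
     bilinear_map (smul P) (smul P) sV h \<and> (\<forall>x y. h x y = h y x) \<and>
     bilinear_map (smul P) (smul P) sV H \<and> (\<forall>x y. H x y = - H y x) \<and>
     (\<forall>x y z. \<mu> x (h y z) - h (x \<bullet>\<^bsub>P\<^esub> y) z + h x (y \<bullet>\<^bsub>P\<^esub> z) - \<mu> z (h x y) = 0) \<and>
     (\<forall>x y z. \<rho> x (H y z) + \<rho> y (H z x) + \<rho> z (H x y)
        + H x \<lbrace>y, z\<rbrace>\<^bsub>P\<^esub> + H y \<lbrace>z, x\<rbrace>\<^bsub>P\<^esub> + H z \<lbrace>x, y\<rbrace>\<^bsub>P\<^esub> = 0) \<and>
     (\<forall>x y z. \<rho> x (h y z) - h \<lbrace>x, y\<rbrace>\<^bsub>P\<^esub> z - h y \<lbrace>x, z\<rbrace>\<^bsub>P\<^esub>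
        + H x (y \<bullet>\<^bsub>P\<^esub> z) - \<mu> y (H x z) - \<mu> z (H x y) = 0)}"

definition cohomologous ::
  "('k::field, 'p::ab_group_add) poisson \<Rightarrow> ('k \<Rightarrow> 'v::ab_group_add \<Rightarrow> 'v)
    \<Rightarrow> ('p \<Rightarrow> 'v \<Rightarrow> 'v) \<Rightarrow> ('p \<Rightarrow> 'v \<Rightarrow> 'v) \<Rightarrow> ('p, 'v) cochain2 rel" where
  "cohomologous P sV \<mu> \<rho> = {((h, H), (h', H')).
     (h, H) \<in> cocycles2 P sV \<mu> \<rho> \<and> (h', H') \<in> cocycles2 P sV \<mu> \<rho> \<and>
     (\<exists>\<phi>. Vector_Spaces.linear (smul P) sV \<phi> \<and>
        (\<forall>x y. h x y - h' x y = \<mu> x (\<phi> y) - \<phi> (x \<bullet>\<^bsub>P\<^esub> y) + \<mu> y (\<phi> x)) \<and>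
        (\<forall>x y. H x y - H' x y = \<rho> x (\<phi> y) - \<phi> \<lbrace>x, y\<rbrace>\<^bsub>P\<^esub> - \<rho> y (\<phi> x)))}"

definition cohom_class ::
  "('k::field, 'p::ab_group_add) poisson \<Rightarrow> ('k \<Rightarrow> 'v::ab_group_add \<Rightarrow> 'v)
    \<Rightarrow> ('p \<Rightarrow> 'v \<Rightarrow> 'v) \<Rightarrow> ('p \<Rightarrow> 'v \<Rightarrow> 'v) \<Rightarrow> ('p, 'v) cochain2 \<Rightarrow> ('p, 'v) cochain2 set" where
  "cohom_class P sV \<mu> \<rho> c = cohomologous P sV \<mu> \<rho> `` {c}"

text \<open>The second Flato--Gerstenhaber--Voronov cohomology space. HOL-Algebra modules extend rings,
  so the ring multiplication and unit are fields of the record; a vector space does not use them.\<close>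

definition H2_FGV ::
  "('k::field, 'p::ab_group_add) poisson \<Rightarrow> ('k \<Rightarrow> 'v::ab_group_add \<Rightarrow> 'v)
    \<Rightarrow> ('p \<Rightarrow> 'v \<Rightarrow> 'v) \<Rightarrow> ('p \<Rightarrow> 'v \<Rightarrow> 'v) \<Rightarrow> ('k, ('p, 'v) cochain2 set) module" where
  "H2_FGV P sV \<mu> \<rho> =
     \<lparr>carrier = cocycles2 P sV \<mu> \<rho> // cohomologous P sV \<mu> \<rho>,
      mult = undefined, one = undefined,
      zero = cohom_class P sV \<mu> \<rho> 0,
      add = (\<lambda>X Y. \<Union>c\<in>X. \<Union>d\<in>Y. cohom_class P sV \<mu> \<rho> (c + d)),
      smult = (\<lambda>a X. \<Union>(h, H)\<in>X.
        cohom_class P sV \<mu> \<rho> ((\<lambda>x y. sV a (h x y)), (\<lambda>x y. sV a (H x y))))\<rparr>"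

text \<open>The values of the cocycle lie in \<open>range i\<close>; \<open>the_inv i\<close> reads them in \<open>V\<close>.\<close>

definition section_cocycle ::
  "('k, 'p::ab_group_add) poisson \<Rightarrow> ('k, 'e::ab_group_add) poisson
    \<Rightarrow> ('v \<Rightarrow> 'e) \<Rightarrow> ('p \<Rightarrow> 'e) \<Rightarrow> ('p, 'v) cochain2" where
  "section_cocycle P E i s =
     ((\<lambda>x y. the_inv i (s x \<bullet>\<^bsub>E\<^esub> s y - s (x \<bullet>\<^bsub>P\<^esub> y))),
      (\<lambda>x y. the_inv i (\<lbrace>s x, s y\<rbrace>\<^bsub>E\<^esub> - s \<lbrace>x, y\<rbrace>\<^bsub>P\<^esub>)))"

definition twist :: "('v \<Rightarrow> 'v) \<times> ('p \<Rightarrow> 'p) \<Rightarrow> ('p, 'v) cochain2 \<Rightarrow> ('p, 'v) cochain2" where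
  "twist = (\<lambda>(\<beta>, \<alpha>) (h, H).
     ((\<lambda>x y. \<beta> (h (the_inv \<alpha> x) (the_inv \<alpha> y))), (\<lambda>x y. \<beta> (H (the_inv \<alpha> x) (the_inv \<alpha> y)))))"

definition wells ::
  "('k::field, 'p::ab_group_add) poisson \<Rightarrow> ('k \<Rightarrow> 'v::ab_group_add \<Rightarrow> 'v)
    \<Rightarrow> ('p \<Rightarrow> 'v \<Rightarrow> 'v) \<Rightarrow> ('p \<Rightarrow> 'v \<Rightarrow> 'v) \<Rightarrow> ('k, 'e::ab_group_add) poisson
    \<Rightarrow> ('v \<Rightarrow> 'e) \<Rightarrow> ('p \<Rightarrow> 'e) \<Rightarrow> ('v \<Rightarrow> 'v) \<times> ('p \<Rightarrow> 'p) \<Rightarrow> ('p, 'v) cochain2 set" where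
  "wells P sV \<mu> \<rho> E i s g =
     cohom_class P sV \<mu> \<rho> (twist g (section_cocycle P E i s) - section_cocycle P E i s)"

end

theory Submission
  imports Defs
begin

text \<open>
  A linear section \<open>s\<close> splits \<open>E\<close> as a vector space into elements \<open>i v + s x\<close>, whose products and
  brackets are governed by \<open>\<mu>\<close>, \<open>\<rho>\<close> and the cocycle \<open>(h, H)\<close> of \<open>s\<close>. A lift of a compatible pair
  \<open>(\<beta>, \<alpha>)\<close> to \<open>E\<close> must have the form \<open>i v + s x \<mapsto> i (\<beta> v + \<phi> (\<alpha> x)) + s (\<alpha> x)\<close> for some linear
  \<open>\<phi> : P \<rightarrow> V\<close>, and such a map preserves the Poisson structure exactly when the coboundary of \<open>\<phi>\<close> is
  the difference between the twist of \<open>(h, H)\<close> and \<open>(h, H)\<close> itself.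
\<close>

section \<open>Linear and bilinear maps, and their inverses\<close>

lemma the_inv_rules:
  assumes "bij f"
  shows "the_inv f (f x) = x" "f (the_inv f y) = y"
  using assms by (simp_all add: bij_is_inj the_inv_f_f f_the_inv_into_f_bij_betw)

lemma bij_the_inv: "bij f \<Longrightarrow> bij (the_inv f)"
  by (simp add: bij_betw_the_inv_into)

lemma linear_rules:
  assumes "Vector_Spaces.linear s1 s2 f"
  shows "f (x + y) = f x + f y" "f (x - y) = f x - f y" "f (- x) = - f x" "f 0 = 0"
    "f (s1 a x) = s2 a (f x)"
proof -
  interpret Vector_Spaces.linear s1 s2 f by fact
  show "f (x + y) = f x + f y" "f (x - y) = f x - f y" "f (- x) = - f x" "f 0 = 0"
    "f (s1 a x) = s2 a (f x)"
    by (simp_all add: add diff neg zero scale)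
qed

lemma linear_compose:
  assumes "Vector_Spaces.linear s1 s2 f" "Vector_Spaces.linear s2 s3 g"
  shows "Vector_Spaces.linear s1 s3 (\<lambda>x. g (f x))"
  using assms by (simp add: Vector_Spaces.linear_iff)

lemma linear_the_inv:
  assumes f: "Vector_Spaces.linear s1 s2 f" and "bij f"
  shows "Vector_Spaces.linear s2 s1 (the_inv f)"
  using f unfolding Vector_Spaces.linear_iff by (metis the_inv_rules[OF \<open>bij f\<close>])

lemma bilinear_rules:
  assumes "bilinear_map s1 s2 s3 f"
  shows "f (x + x') y = f x y + f x' y" "f (x - x') y = f x y - f x' y"
    "f (- x) y = - f x y" "f 0 y = 0" "f (s1 a x) y = s3 a (f x y)"
    "f x (y + y') = f x y + f x y'" "f x (y - y') = f x y - f x y'"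
    "f x (- y) = - f x y" "f x 0 = 0" "f x (s2 a y) = s3 a (f x y)"
proof -
  have "Vector_Spaces.linear s2 s3 (\<lambda>y. f x y)" "Vector_Spaces.linear s1 s3 (\<lambda>x. f x y)" for x y
    using assms by (simp_all add: bilinear_map_def)
  then show "f (x + x') y = f x y + f x' y" "f (x - x') y = f x y - f x' y"
    "f (- x) y = - f x y" "f 0 y = 0" "f (s1 a x) y = s3 a (f x y)"
    "f x (y + y') = f x y + f x y'" "f x (y - y') = f x y - f x y'"
    "f x (- y) = - f x y" "f x 0 = 0" "f x (s2 a y) = s3 a (f x y)"
    using linear_rules[of s2 s3 "\<lambda>y. f x y" for x] linear_rules[of s1 s3 "\<lambda>x. f x y" for y]
    by metis+
qed

lemma bilinear_mapI:
  assumes "vector_space s1" "vector_space s2" "vector_space s3"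
    and "\<And>x x' y. f (x + x') y = f x y + f x' y" "\<And>a x y. f (s1 a x) y = s3 a (f x y)"
    and "\<And>x y y'. f x (y + y') = f x y + f x y'" "\<And>a x y. f x (s2 a y) = s3 a (f x y)"
  shows "bilinear_map s1 s2 s3 f"
  using assms by (simp add: bilinear_map_def Vector_Spaces.linear_iff)

lemma bilinear_map_zero:
  assumes "vector_space s1" "vector_space s2" "vector_space s3"
  shows "bilinear_map s1 s2 s3 (\<lambda>x y. 0)"
proof -
  interpret vector_space s3 by fact
  show ?thesis using assms by (intro bilinear_mapI) auto
qed

lemma bilinear_map_diff:
  assumes f: "bilinear_map s1 s2 s3 f" and g: "bilinear_map s1 s2 s3 g"
  shows "bilinear_map s1 s2 s3 (\<lambda>x y. f x y - g x y)"
proof -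
  have vs: "vector_space s1" "vector_space s2" "vector_space s3"
    using f by (simp_all add: bilinear_map_def Vector_Spaces.linear_iff)
  interpret vector_space s3 by fact
  show ?thesis
    by (intro bilinear_mapI vs)
      (simp_all add: bilinear_rules[OF f] bilinear_rules[OF g] scale_right_diff_distrib)
qed

lemma bilinear_map_compose:
  assumes f: "bilinear_map s1 s2 s3 f" and lin: "Vector_Spaces.linear t1 s1 g1"
    "Vector_Spaces.linear t2 s2 g2" "Vector_Spaces.linear s3 t3 g3"
  shows "bilinear_map t1 t2 t3 (\<lambda>x y. g3 (f (g1 x) (g2 y)))"
proof -
  have vs: "vector_space t1" "vector_space t2" "vector_space t3"
    using lin by (simp_all add: Vector_Spaces.linear_iff)
  show ?thesis
    by (intro bilinear_mapI vs)
      (simp_all add: bilinear_rules[OF f] lin[THEN linear_rules(1)] lin[THEN linear_rules(5)])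
qed

section \<open>Poisson homomorphisms and automorphism groups\<close>

lemma poisson_hom_id: "vector_space (smul A) \<Longrightarrow> poisson_hom A A id"
  by (simp add: poisson_hom_def Vector_Spaces.linear_iff)

lemma poisson_hom_comp: "poisson_hom A B f \<Longrightarrow> poisson_hom B C g \<Longrightarrow> poisson_hom A C (g \<circ> f)"
  by (simp add: poisson_hom_def Vector_Spaces.linear_iff)

lemma poisson_hom_the_inv:
  assumes f: "poisson_hom A B f" and "bij f"
  shows "poisson_hom B A (the_inv f)"
  using f unfolding poisson_hom_def Vector_Spaces.linear_iff by (metis the_inv_rules[OF \<open>bij f\<close>])

lemma poisson_Aut_simps [simp]:
  "f \<in> carrier (poisson_Aut A) \<longleftrightarrow> poisson_hom A A f \<and> bij f"
  "mult (poisson_Aut A) = (\<circ>)" "one (poisson_Aut A) = id"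
  by (simp_all add: poisson_Aut_def)

lemma group_poisson_Aut:
  assumes "vector_space (smul A)"
  shows "group (poisson_Aut A)"
proof (rule groupI)
  fix f assume f: "f \<in> carrier (poisson_Aut A)"
  have "the_inv f \<in> carrier (poisson_Aut A)"
    using f by (simp add: poisson_hom_the_inv bij_the_inv)
  moreover have "the_inv f \<circ> f = id"
    using f by (simp add: fun_eq_iff the_inv_rules)
  ultimately show "\<exists>g\<in>carrier (poisson_Aut A). g \<otimes>\<^bsub>poisson_Aut A\<^esub> f = \<one>\<^bsub>poisson_Aut A\<^esub>"
    by auto
qed (use assms in \<open>auto intro: poisson_hom_id poisson_hom_comp bij_comp simp: comp_assoc\<close>)

text \<open>Makes the group inverse a concrete function, so that closure of the later subgroups
  under inverses can be checked pointwise.\<close>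

lemma inv_poisson_Aut:
  assumes "vector_space (smul A)" "f \<in> carrier (poisson_Aut A)"
  shows "inv\<^bsub>poisson_Aut A\<^esub> f = the_inv f"
proof -
  interpret group "poisson_Aut A" using assms(1) by (rule group_poisson_Aut)
  show ?thesis
    using assms(2)
    by (intro inv_equality)
      (auto simp: fun_eq_iff the_inv_rules poisson_hom_the_inv bij_the_inv)
qed

section \<open>Cocycles and the cohomology relation\<close>

lemma cohom_class_eq_iff:
  assumes "equiv (cocycles2 P sV \<mu> \<rho>) (cohomologous P sV \<mu> \<rho>)"
    and "c \<in> cocycles2 P sV \<mu> \<rho>" "d \<in> cocycles2 P sV \<mu> \<rho>"
  shows "cohom_class P sV \<mu> \<rho> c = cohom_class P sV \<mu> \<rho> d \<longleftrightarrow> (c, d) \<in> cohomologous P sV \<mu> \<rho>"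
  using eq_equiv_class_iff[OF assms] by (simp add: cohom_class_def)

context poisson_representation
begin

text \<open>The representation locale takes \<open>P\<close> as a bare record; that its scalars form
  a vector space is part of the linearity of \<open>\<mu>\<close> in its first argument.\<close>

lemma vector_space_P: "vector_space (smul P)"
  using bilinear_\<mu> by (simp add: bilinear_map_def Vector_Spaces.linear_iff)

lemmas action_rules = bilinear_rules[OF bilinear_\<mu>] bilinear_rules[OF bilinear_\<rho>]

lemma cocycles2I:
  assumes "bilinear_map (smul P) (smul P) sV h" "bilinear_map (smul P) (smul P) sV H"
    "\<And>x y. h x y = h y x" "\<And>x y. H x y = - H y x"
    "\<And>x y z. \<mu> x (h y z) - h (x \<bullet> y) z + h x (y \<bullet> z) - \<mu> z (h x y) = 0"
    "\<And>x y z. \<rho> x (H y z) + \<rho> y (H z x) + \<rho> z (H x y)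
       + H x \<lbrace>y, z\<rbrace> + H y \<lbrace>z, x\<rbrace> + H z \<lbrace>x, y\<rbrace> = 0"
    "\<And>x y z. \<rho> x (h y z) - h \<lbrace>x, y\<rbrace> z - h y \<lbrace>x, z\<rbrace>
       + H x (y \<bullet> z) - \<mu> y (H x z) - \<mu> z (H x y) = 0"
  shows "(h, H) \<in> cocycles2 P sV \<mu> \<rho>"
  unfolding cocycles2_def mem_Collect_eq case_prod_conv by (intro conjI allI assms)

lemma cocycles2D:
  assumes "(h, H) \<in> cocycles2 P sV \<mu> \<rho>"
  shows "bilinear_map (smul P) (smul P) sV h" "bilinear_map (smul P) (smul P) sV H"
    "\<And>x y. h x y = h y x" "\<And>x y. H x y = - H y x"
    "\<And>x y z. \<mu> x (h y z) - h (x \<bullet> y) z + h x (y \<bullet> z) - \<mu> z (h x y) = 0"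
    "\<And>x y z. \<rho> x (H y z) + \<rho> y (H z x) + \<rho> z (H x y)
       + H x \<lbrace>y, z\<rbrace> + H y \<lbrace>z, x\<rbrace> + H z \<lbrace>x, y\<rbrace> = 0"
    "\<And>x y z. \<rho> x (h y z) - h \<lbrace>x, y\<rbrace> z - h y \<lbrace>x, z\<rbrace>
       + H x (y \<bullet> z) - \<mu> y (H x z) - \<mu> z (H x y) = 0"
  using assms unfolding cocycles2_def mem_Collect_eq case_prod_conv by blast+

lemma zero_cocycle: "0 \<in> cocycles2 P sV \<mu> \<rho>"
  unfolding zero_prod_def zero_fun_def
  by (rule cocycles2I) (simp_all add: action_rules bilinear_map_zero vector_space vector_space_P)

lemma diff_cocycle:
  assumes "c \<in> cocycles2 P sV \<mu> \<rho>" "d \<in> cocycles2 P sV \<mu> \<rho>"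
  shows "c - d \<in> cocycles2 P sV \<mu> \<rho>"
proof -
  obtain h H h' H' where cd: "c = (h, H)" "d = (h', H')" by (cases c, cases d)
  note c = cocycles2D[OF assms(1)[unfolded cd]] and d = cocycles2D[OF assms(2)[unfolded cd]]
  have "((\<lambda>x y. h x y - h' x y), (\<lambda>x y. H x y - H' x y)) \<in> cocycles2 P sV \<mu> \<rho>"
  proof (rule cocycles2I)
    fix x y z
    show "h x y - h' x y = h y x - h' y x" "H x y - H' x y = - (H y x - H' y x)"
      using c(3,4)[of x y] d(3,4)[of x y] by simp_all
    show "\<mu> x (h y z - h' y z) - (h (x \<bullet> y) z - h' (x \<bullet> y) z) + (h x (y \<bullet> z) - h' x (y \<bullet> z))
        - \<mu> z (h x y - h' x y) = 0"
      \<comment> \<open>The cocycle conditions are linear in the pair, so each one for the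
        difference is the difference of the two given instances.\<close>
      using arg_cong2[where f = minus, OF c(5) d(5), of x y z x y z]
      by (simp add: action_rules algebra_simps)
    show "\<rho> x (H y z - H' y z) + \<rho> y (H z x - H' z x) + \<rho> z (H x y - H' x y)
        + (H x \<lbrace>y, z\<rbrace> - H' x \<lbrace>y, z\<rbrace>) + (H y \<lbrace>z, x\<rbrace> - H' y \<lbrace>z, x\<rbrace>) + (H z \<lbrace>x, y\<rbrace> - H' z \<lbrace>x, y\<rbrace>) = 0"
      using arg_cong2[where f = minus, OF c(6) d(6), of x y z x y z]
      by (simp add: action_rules algebra_simps)
    show "\<rho> x (h y z - h' y z) - (h \<lbrace>x, y\<rbrace> z - h' \<lbrace>x, y\<rbrace> z) - (h y \<lbrace>x, z\<rbrace> - h' y \<lbrace>x, z\<rbrace>)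
        + (H x (y \<bullet> z) - H' x (y \<bullet> z)) - \<mu> y (H x z - H' x z) - \<mu> z (H x y - H' x y) = 0"
      using arg_cong2[where f = minus, OF c(7) d(7), of x y z x y z]
      by (simp add: action_rules algebra_simps)
  qed (intro bilinear_map_diff c d)+
  then show ?thesis
    by (simp add: cd fun_diff_def)
qed

text \<open>The coboundary is additive in the linear map that produces it, so the maps 0,
  \<open>- \<phi>\<close> and \<open>\<phi> + \<psi>\<close> witness reflexivity, symmetry and
  transitivity.\<close>

lemma equiv_cohomologous: "equiv (cocycles2 P sV \<mu> \<rho>) (cohomologous P sV \<mu> \<rho>)"
proof (rule equivI)
  interpret V: vector_space sV by (rule vector_space)
  have lin: "Vector_Spaces.linear (smul P) sV (\<lambda>x. 0)"
    by (simp add: Vector_Spaces.linear_iff vector_space_P vector_space)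
  show "cohomologous P sV \<mu> \<rho> \<subseteq> cocycles2 P sV \<mu> \<rho> \<times> cocycles2 P sV \<mu> \<rho>"
    by (auto simp: cohomologous_def)
  show "refl_on (cocycles2 P sV \<mu> \<rho>) (cohomologous P sV \<mu> \<rho>)"
  proof (rule refl_onI)
    fix c assume "c \<in> cocycles2 P sV \<mu> \<rho>"
    then show "(c, c) \<in> cohomologous P sV \<mu> \<rho>"
      using lin by (cases c) (auto simp: cohomologous_def action_rules intro!: exI[of _ "\<lambda>x. 0"])
  qed
  show "sym (cohomologous P sV \<mu> \<rho>)"
  proof (rule symI)
    fix c d assume "(c, d) \<in> cohomologous P sV \<mu> \<rho>"
    then obtain h H h' H' \<phi> where cd: "c = (h, H)" "d = (h', H')"
      "c \<in> cocycles2 P sV \<mu> \<rho>" "d \<in> cocycles2 P sV \<mu> \<rho>"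
      and \<phi>: "Vector_Spaces.linear (smul P) sV \<phi>"
      and *: "\<And>x y. h x y - h' x y = \<mu> x (\<phi> y) - \<phi> (x \<bullet> y) + \<mu> y (\<phi> x)"
        "\<And>x y. H x y - H' x y = \<rho> x (\<phi> y) - \<phi> \<lbrace>x, y\<rbrace> - \<rho> y (\<phi> x)"
      by (auto simp: cohomologous_def)
    have "Vector_Spaces.linear (smul P) sV (\<lambda>x. - \<phi> x)"
      using \<phi> by (simp add: Vector_Spaces.linear_iff)
    \<comment> \<open>Written as negatives, the differences can be rewritten by \<open>*\<close>;
      \<open>minus_diff_eq\<close> would turn this form back and is therefore switched off
      below.\<close>
    moreover have "h' x y - h x y = - (h x y - h' x y)" "H' x y - H x y = - (H x y - H' x y)" for x y
      by simp_all
    ultimately show "(d, c) \<in> cohomologous P sV \<mu> \<rho>"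
      using cd unfolding cohomologous_def
      by (auto simp: * action_rules simp del: minus_diff_eq intro!: exI[of _ "\<lambda>x. - \<phi> x"])
  qed
  show "trans (cohomologous P sV \<mu> \<rho>)"
  proof (rule transI)
    fix c d e assume cd: "(c, d) \<in> cohomologous P sV \<mu> \<rho>" and de: "(d, e) \<in> cohomologous P sV \<mu> \<rho>"
    obtain h H h' H' h'' H'' where eqs: "c = (h, H)" "d = (h', H')" "e = (h'', H'')"
      by (cases c, cases d, cases e)
    from cd obtain \<phi> where \<phi>: "Vector_Spaces.linear (smul P) sV \<phi>"
      and 1: "\<And>x y. h x y - h' x y = \<mu> x (\<phi> y) - \<phi> (x \<bullet> y) + \<mu> y (\<phi> x)"
        "\<And>x y. H x y - H' x y = \<rho> x (\<phi> y) - \<phi> \<lbrace>x, y\<rbrace> - \<rho> y (\<phi> x)"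
      by (auto simp: cohomologous_def eqs)
    from de obtain \<psi> where \<psi>: "Vector_Spaces.linear (smul P) sV \<psi>"
      and 2: "\<And>x y. h' x y - h'' x y = \<mu> x (\<psi> y) - \<psi> (x \<bullet> y) + \<mu> y (\<psi> x)"
        "\<And>x y. H' x y - H'' x y = \<rho> x (\<psi> y) - \<psi> \<lbrace>x, y\<rbrace> - \<rho> y (\<psi> x)"
      by (auto simp: cohomologous_def eqs)
    have "Vector_Spaces.linear (smul P) sV (\<lambda>x. \<phi> x + \<psi> x)"
      using \<phi> \<psi> by (simp add: Vector_Spaces.linear_iff V.scale_right_distrib)
    moreover have "h x y - h'' x y = (h x y - h' x y) + (h' x y - h'' x y)"
      "H x y - H'' x y = (H x y - H' x y) + (H' x y - H'' x y)" for x y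
      by simp_all
    ultimately show "(c, e) \<in> cohomologous P sV \<mu> \<rho>"
      using cd de unfolding cohomologous_def eqs
      by (auto simp: 1 2 action_rules simp del: diff_add_cancel add_diff_cancel
          intro!: exI[of _ "\<lambda>x. \<phi> x + \<psi> x"])
  qed
qed

section \<open>Compatible pairs and their action on cocycles\<close>

lemma carrier_compatible_pairs:
  "(\<beta>, \<alpha>) \<in> carrier (compatible_pairs P sV \<mu> \<rho>) \<longleftrightarrow>
    Vector_Spaces.linear sV sV \<beta> \<and> bij \<beta> \<and> poisson_hom P P \<alpha> \<and> bij \<alpha> \<and>
    (\<forall>x v. \<beta> (\<mu> x v) = \<mu> (\<alpha> x) (\<beta> v)) \<and> (\<forall>x v. \<beta> (\<rho> x v) = \<rho> (\<alpha> x) (\<beta> v))"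
  \<comment> \<open>Both operations on \<open>V\<close> are zero, so the homomorphism conditions on
    \<open>\<beta>\<close> reduce to \<open>\<beta> 0 = 0\<close>, which linearity provides.\<close>
  by (auto simp: compatible_pairs_def poisson_hom_def trivial_poisson_def linear_rules(4))

lemma group_compatible_pairs: "group (compatible_pairs P sV \<mu> \<rho>)"
proof -
  let ?G = "poisson_Aut (trivial_poisson sV)" and ?H = "poisson_Aut P"
  let ?C = "carrier (compatible_pairs P sV \<mu> \<rho>)"
  have vs: "vector_space (smul (trivial_poisson sV))"
    by (simp add: trivial_poisson_def vector_space)
  interpret G: group ?G using vs by (rule group_poisson_Aut)
  interpret H: group ?H using vector_space_P by (rule group_poisson_Aut)
  interpret GH: group "?G \<times>\<times> ?H" by (intro DirProd_group G.is_group H.is_group)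
  have C_subset: "?C \<subseteq> carrier (?G \<times>\<times> ?H)"
    by (auto simp: compatible_pairs_def)
  have "subgroup ?C (?G \<times>\<times> ?H)"
  proof
    show "?C \<subseteq> carrier (?G \<times>\<times> ?H)" by (fact C_subset)
    show "\<one>\<^bsub>?G \<times>\<times> ?H\<^esub> \<in> ?C"
      using GH.one_closed by (simp add: compatible_pairs_def)
    show "g \<otimes>\<^bsub>?G \<times>\<times> ?H\<^esub> g' \<in> ?C" if "g \<in> ?C" "g' \<in> ?C" for g g'
    proof -
      have "g \<otimes>\<^bsub>?G \<times>\<times> ?H\<^esub> g' \<in> carrier (?G \<times>\<times> ?H)"
        using that C_subset by blast
      then show ?thesis
        using that by (cases g, cases g') (auto simp: compatible_pairs_def)
    qed
    show "inv\<^bsub>?G \<times>\<times> ?H\<^esub> g \<in> ?C" if g: "g \<in> ?C" for g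
    proof -
      obtain \<beta> \<alpha> where [simp]: "g = (\<beta>, \<alpha>)" by (cases g)
      have c: "\<beta> \<in> carrier ?G" "\<alpha> \<in> carrier ?H"
        using g C_subset by auto
      have inv: "inv\<^bsub>?G \<times>\<times> ?H\<^esub> g = (the_inv \<beta>, the_inv \<alpha>)"
        using c inv_DirProd[OF G.is_group H.is_group c]
        by (simp add: inv_poisson_Aut vs vector_space_P)
      have *: "the_inv \<beta> (\<beta> v) = v" "\<beta> (the_inv \<beta> v) = v" "\<alpha> (the_inv \<alpha> x) = x" for x v
        using c by (simp_all add: the_inv_rules)
      have "the_inv \<beta> (\<mu> x v) = \<mu> (the_inv \<alpha> x) (the_inv \<beta> v)"
        "the_inv \<beta> (\<rho> x v) = \<rho> (the_inv \<alpha> x) (the_inv \<beta> v)" for x v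
        \<comment> \<open>Evaluate the compatibility conditions at the preimages of \<open>x\<close>
          and \<open>v\<close>, then cancel \<open>\<beta>\<close>.\<close>
        using g unfolding \<open>g = _\<close> carrier_compatible_pairs by (metis *)+
      moreover have "inv\<^bsub>?G \<times>\<times> ?H\<^esub> g \<in> carrier (?G \<times>\<times> ?H)"
        using g C_subset by blast
      ultimately show ?thesis
        unfolding inv by (simp add: compatible_pairs_def)
    qed
  qed
  then show ?thesis
    using GH.subgroup_imp_group by (simp add: compatible_pairs_def)
qed

text \<open>Compatibility lets \<open>\<beta>\<close> be pulled out of both actions, and the inverse
  of \<open>\<alpha>\<close> respects product and bracket. Each condition for the twist at
  \<open>x\<close>, \<open>y\<close>, \<open>z\<close> is thus \<open>\<beta>\<close> applied to the
  same condition for \<open>c\<close> at the preimages under \<open>\<alpha>\<close>.\<close>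

lemma twist_cocycle:
  assumes g: "g \<in> carrier (compatible_pairs P sV \<mu> \<rho>)" and c: "c \<in> cocycles2 P sV \<mu> \<rho>"
  shows "twist g c \<in> cocycles2 P sV \<mu> \<rho>"
proof -
  obtain \<beta> \<alpha> h H where [simp]: "g = (\<beta>, \<alpha>)" "c = (h, H)" by (cases g, cases c)
  define \<alpha>' where "\<alpha>' = the_inv \<alpha>"
  have \<beta>: "Vector_Spaces.linear sV sV \<beta>"
    and \<alpha>: "poisson_hom P P \<alpha>" "bij \<alpha>"
    and compat: "\<And>x v. \<beta> (\<mu> x v) = \<mu> (\<alpha> x) (\<beta> v)" "\<And>x v. \<beta> (\<rho> x v) = \<rho> (\<alpha> x) (\<beta> v)"
    using g by (auto simp: carrier_compatible_pairs)
  have \<alpha>\<alpha>': "\<alpha> (\<alpha>' x) = x" for x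
    using \<alpha>(2) by (simp add: \<alpha>'_def the_inv_rules)
  have \<alpha>': "Vector_Spaces.linear (smul P) (smul P) \<alpha>'" "\<alpha>' (x \<bullet> y) = \<alpha>' x \<bullet> \<alpha>' y"
    "\<alpha>' \<lbrace>x, y\<rbrace> = \<lbrace>\<alpha>' x, \<alpha>' y\<rbrace>" for x y
    using poisson_hom_the_inv[OF \<alpha>] by (simp_all add: poisson_hom_def \<alpha>'_def)
  have compat': "\<mu> x (\<beta> v) = \<beta> (\<mu> (\<alpha>' x) v)" "\<rho> x (\<beta> v) = \<beta> (\<rho> (\<alpha>' x) v)" for x v
    by (simp_all add: compat \<alpha>\<alpha>')
  \<comment> \<open>Oriented to collect sums and differences of values of \<open>\<beta>\<close>
    under a single \<open>\<beta>\<close>.\<close>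
  note \<beta>_rules = linear_rules(1-3)[OF \<beta>, symmetric]
  note c' = cocycles2D[OF c[unfolded \<open>c = _\<close>]]
  have "((\<lambda>x y. \<beta> (h (\<alpha>' x) (\<alpha>' y))), (\<lambda>x y. \<beta> (H (\<alpha>' x) (\<alpha>' y)))) \<in> cocycles2 P sV \<mu> \<rho>"
    unfolding cocycles2_def mem_Collect_eq case_prod_conv compat' \<alpha>' \<beta>_rules
    using c'(5-7)
    by (intro conjI allI bilinear_map_compose[OF c'(1) \<alpha>'(1) \<alpha>'(1) \<beta>]
        bilinear_map_compose[OF c'(2) \<alpha>'(1) \<alpha>'(1) \<beta>] arg_cong[where f = \<beta>] c'(3,4))
      (simp_all add: linear_rules(4)[OF \<beta>])
  then show ?thesis
    by (simp add: twist_def \<alpha>'_def)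
qed

end

section \<open>Abelian extensions with a chosen section\<close>

lemma (in poisson_algebra) brk_skew: "\<lbrace>x, y\<rbrace> = - \<lbrace>y, x\<rbrace>"
proof -
  \<comment> \<open>Polarization of the alternating law.\<close>
  have "\<lbrace>x + y, x + y\<rbrace> = \<lbrace>x, x\<rbrace> + \<lbrace>x, y\<rbrace> + (\<lbrace>y, x\<rbrace> + \<lbrace>y, y\<rbrace>)"
    by (simp add: bilinear_rules[OF bilinear_brk])
  then show ?thesis
    by (simp add: brk_alternating eq_neg_iff_add_eq_0)
qed

text \<open>The constants \<open>tau\<close>, \<open>section_cocycle\<close> and
  \<open>wells\<close> all take the section as an argument, so a single arbitrary one is fixed for
  the rest of the argument.\<close>

locale sectioned_extension =
  P: poisson_algebra P + poisson_representation P sV \<mu> \<rho> + abelian_extension P sV \<mu> \<rho> E i p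
  for P :: "('k::field, 'p::ab_group_add) poisson" (structure)
    and sV :: "'k \<Rightarrow> 'v::ab_group_add \<Rightarrow> 'v"
    and \<mu> \<rho> :: "'p \<Rightarrow> 'v \<Rightarrow> 'v"
    and E :: "('k, 'e::ab_group_add) poisson"
    and i :: "'v \<Rightarrow> 'e" and p :: "'e \<Rightarrow> 'p" +
  fixes s :: "'p \<Rightarrow> 'e"
  assumes section_s: "linear_section P E p s"
begin

sublocale E: poisson_algebra E
  by (rule poisson_E)

lemma linear_i: "Vector_Spaces.linear sV (smul E) i"
  using hom_i by (simp add: poisson_hom_def trivial_poisson_def)

lemma linear_p: "Vector_Spaces.linear (smul E) (smul P) p"
  using hom_p by (simp add: poisson_hom_def)

lemma linear_s: "Vector_Spaces.linear (smul P) (smul E) s"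
  using section_s by (simp add: linear_section_def)

lemmas i_rules = linear_rules[OF linear_i]
  and p_rules = linear_rules[OF linear_p]
  and s_rules = linear_rules[OF linear_s]
  and P_rules = bilinear_rules[OF P.bilinear_prd] bilinear_rules[OF P.bilinear_brk]
  and E_rules = bilinear_rules[OF E.bilinear_prd] bilinear_rules[OF E.bilinear_brk]

lemma i_eq_iff [simp]: "i v = i w \<longleftrightarrow> v = w"
  using inj_i by (simp add: inj_eq)

lemma p_i [simp]: "p (i v) = 0"
  using exact by blast

lemma p_s [simp]: "p (s x) = x"
  using section_s by (simp add: linear_section_def fun_eq_iff)

lemma p_prd: "p (a \<bullet>\<^bsub>E\<^esub> b) = p a \<bullet> p b" and p_brk: "p \<lbrace>a, b\<rbrace>\<^bsub>E\<^esub> = \<lbrace>p a, p b\<rbrace>"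
  using hom_p by (simp_all add: poisson_hom_def)

lemma i_prd_i: "i v \<bullet>\<^bsub>E\<^esub> i w = 0" and i_brk_i: "\<lbrace>i v, i w\<rbrace>\<^bsub>E\<^esub> = 0"
  using hom_i i_rules(4) by (simp_all add: poisson_hom_def trivial_poisson_def)

lemma i_\<mu>: "i (\<mu> x v) = s x \<bullet>\<^bsub>E\<^esub> i v" and i_\<rho>: "i (\<rho> x v) = \<lbrace>s x, i v\<rbrace>\<^bsub>E\<^esub>"
  by (rule \<mu>_section[OF section_s], rule \<rho>_section[OF section_s])

text \<open>Exactness at \<open>E\<close>: the kernel of \<open>p\<close> is the range of
  \<open>i\<close>. Every use of \<open>the_inv i\<close> is justified by first checking that
  \<open>p\<close> kills the element.\<close>

lemma i_the_inv: "p e = 0 \<Longrightarrow> i (the_inv i e) = e"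
  using exact inj_i by (auto intro: f_the_inv_into_f)

lemma decompose:
  obtains v where "e = i v + s (p e)"
proof
  show "e = i (the_inv i (e - s (p e))) + s (p e)"
    by (simp add: i_the_inv p_rules)
qed

text \<open>The actions are given through the section, but products and brackets inside
  \<open>V\<close> vanish, so the \<open>V\<close>-component of \<open>e\<close> contributes
  nothing. This allows arbitrary lifts such as \<open>\<gamma> (s x)\<close> in place of values of
  \<open>s\<close>.\<close>

lemma prd_i: "e \<bullet>\<^bsub>E\<^esub> i v = i (\<mu> (p e) v)" and brk_i: "\<lbrace>e, i v\<rbrace>\<^bsub>E\<^esub> = i (\<rho> (p e) v)"
proof -
  obtain w where e: "e = i w + s (p e)" by (rule decompose)
  show "e \<bullet>\<^bsub>E\<^esub> i v = i (\<mu> (p e) v)"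
    by (subst e) (simp add: E_rules i_prd_i i_\<mu>)
  show "\<lbrace>e, i v\<rbrace>\<^bsub>E\<^esub> = i (\<rho> (p e) v)"
    by (subst e) (simp add: E_rules i_brk_i i_\<rho>)
qed

section \<open>The cocycle of the section\<close>

definition "h x y = the_inv i (s x \<bullet>\<^bsub>E\<^esub> s y - s (x \<bullet> y))"

definition "H x y = the_inv i (\<lbrace>s x, s y\<rbrace>\<^bsub>E\<^esub> - s \<lbrace>x, y\<rbrace>)"

lemma section_cocycle_eq: "section_cocycle P E i s = (h, H)"
  by (simp add: section_cocycle_def h_def H_def fun_eq_iff)

lemma i_h: "i (h x y) = s x \<bullet>\<^bsub>E\<^esub> s y - s (x \<bullet> y)" and i_H: "i (H x y) = \<lbrace>s x, s y\<rbrace>\<^bsub>E\<^esub> - s \<lbrace>x, y\<rbrace>"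
  unfolding h_def H_def by (simp_all add: i_the_inv p_rules p_prd p_brk)

text \<open>As \<open>i\<close> is injective, all identities may be checked in \<open>E\<close>,
  where \<open>h\<close> and \<open>H\<close> become explicit expressions. The three conditions then
  come from associativity, Jacobi and Leibniz in \<open>E\<close>, compared with the same laws in
  \<open>P\<close>.\<close>

lemma section_cocycle: "(h, H) \<in> cocycles2 P sV \<mu> \<rho>"
proof (rule cocycles2I)
  interpret E: vector_space "smul E" by (rule E.vector_space)
  have P_bil: "vector_space (smul P)" "vector_space sV"
    by (rule vector_space_P, rule vector_space)
  show "bilinear_map (smul P) (smul P) sV h" "bilinear_map (smul P) (smul P) sV H"
    unfolding bilinear_map_def Vector_Spaces.linear_iff i_eq_iff[symmetric]
    by (simp_all add: P_bil i_rules i_h i_H s_rules P_rules E_rules E.scale_right_diff_distrib)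
  fix x y z
  have "i (h x y) = i (h y x)"
    by (simp add: i_h P.prd_commute[of x] E.prd_commute[of "s x"])
  then show "h x y = h y x" by simp
  have "i (H x y) = i (- H y x)"
    by (simp add: i_rules i_H P.brk_skew[of x] E.brk_skew[of "s x"] s_rules)
  then show "H x y = - H y x" by simp
  \<comment> \<open>The terms in the image of \<open>s\<close> cancel by associativity in
    \<open>P\<close>, which leaves the associator in \<open>E\<close>.\<close>
  have "i (\<mu> x (h y z) - h (x \<bullet> y) z + h x (y \<bullet> z) - \<mu> z (h x y)) =
    s x \<bullet>\<^bsub>E\<^esub> (s y \<bullet>\<^bsub>E\<^esub> s z) - (s x \<bullet>\<^bsub>E\<^esub> s y) \<bullet>\<^bsub>E\<^esub> s z"
    by (simp add: i_rules i_\<mu> i_h E_rules P.prd_assoc E.prd_commute[of "s z"])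
  also have "\<dots> = i 0" by (simp add: E.prd_assoc i_rules)
  finally show "\<mu> x (h y z) - h (x \<bullet> y) z + h x (y \<bullet> z) - \<mu> z (h x y) = 0" by simp
  have "i (\<rho> x (H y z) + \<rho> y (H z x) + \<rho> z (H x y) + H x \<lbrace>y, z\<rbrace> + H y \<lbrace>z, x\<rbrace> + H z \<lbrace>x, y\<rbrace>) =
    (\<lbrace>s x, \<lbrace>s y, s z\<rbrace>\<^bsub>E\<^esub>\<rbrace>\<^bsub>E\<^esub> + \<lbrace>s y, \<lbrace>s z, s x\<rbrace>\<^bsub>E\<^esub>\<rbrace>\<^bsub>E\<^esub> + \<lbrace>s z, \<lbrace>s x, s y\<rbrace>\<^bsub>E\<^esub>\<rbrace>\<^bsub>E\<^esub>)
    - s (\<lbrace>x, \<lbrace>y, z\<rbrace>\<rbrace> + \<lbrace>y, \<lbrace>z, x\<rbrace>\<rbrace> + \<lbrace>z, \<lbrace>x, y\<rbrace>\<rbrace>)"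
    by (simp add: i_rules i_\<rho> i_H E_rules s_rules)
  also have "\<dots> = i 0" by (simp only: E.jacobi P.jacobi) (simp add: i_rules s_rules)
  finally show "\<rho> x (H y z) + \<rho> y (H z x) + \<rho> z (H x y)
      + H x \<lbrace>y, z\<rbrace> + H y \<lbrace>z, x\<rbrace> + H z \<lbrace>x, y\<rbrace> = 0" by simp
  have "i (\<rho> x (h y z) - h \<lbrace>x, y\<rbrace> z - h y \<lbrace>x, z\<rbrace> + H x (y \<bullet> z) - \<mu> y (H x z) - \<mu> z (H x y)) = i 0"
    by (simp add: i_rules i_\<mu> i_\<rho> i_h i_H E_rules s_rules E.leibniz P.leibniz E.prd_commute[of "s z"])
  then show "\<rho> x (h y z) - h \<lbrace>x, y\<rbrace> z - h y \<lbrace>x, z\<rbrace> + H x (y \<bullet> z) - \<mu> y (H x z) - \<mu> z (H x y) = 0"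
    by simp
qed

section \<open>Automorphisms preserving \<open>V\<close> and the homomorphism
  \<open>tau\<close>\<close>

lemma carrier_Aut_V:
  "\<gamma> \<in> carrier (Aut_V E i) \<longleftrightarrow> poisson_hom E E \<gamma> \<and> bij \<gamma> \<and> \<gamma> ` range i = range i"
  by (simp add: Aut_V_def)

lemma group_Aut_V: "group (Aut_V E i)"
proof -
  interpret G: group "poisson_Aut E" using E.vector_space by (rule group_poisson_Aut)
  have "subgroup {\<gamma> \<in> carrier (poisson_Aut E). \<gamma> ` range i = range i} (poisson_Aut E)"
  proof (rule G.subgroupI)
    have "id \<in> {\<gamma> \<in> carrier (poisson_Aut E). \<gamma> ` range i = range i}"
      using G.one_closed by simp
    then show "{\<gamma> \<in> carrier (poisson_Aut E). \<gamma> ` range i = range i} \<noteq> {}" by blast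
  next
    fix \<gamma> assume "\<gamma> \<in> {\<gamma> \<in> carrier (poisson_Aut E). \<gamma> ` range i = range i}"
    then have \<gamma>: "\<gamma> \<in> carrier (poisson_Aut E)" "\<gamma> ` range i = range i" by auto
    \<comment> \<open>Since \<open>\<gamma>\<close> maps \<open>range i\<close> onto itself,
      applying its inverse to both sides shows that the inverse does too.\<close>
    have "the_inv \<gamma> ` \<gamma> ` range i = range i"
      using \<gamma>(1) by (simp add: image_image the_inv_rules)
    then show "inv\<^bsub>poisson_Aut E\<^esub> \<gamma> \<in> {\<gamma> \<in> carrier (poisson_Aut E). \<gamma> ` range i = range i}"
      using G.inv_closed[OF \<gamma>(1)] inv_poisson_Aut[OF E.vector_space \<gamma>(1)] \<gamma>(2) by simp
  next
    fix \<gamma> \<gamma>' assume *: "\<gamma> \<in> {\<gamma> \<in> carrier (poisson_Aut E). \<gamma> ` range i = range i}"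
      "\<gamma>' \<in> {\<gamma> \<in> carrier (poisson_Aut E). \<gamma> ` range i = range i}"
    then have "(\<gamma> \<circ> \<gamma>') ` range i = range i"
      by (simp only: mem_Collect_eq image_comp[symmetric])
    with * show "\<gamma> \<otimes>\<^bsub>poisson_Aut E\<^esub> \<gamma>' \<in> {\<gamma> \<in> carrier (poisson_Aut E). \<gamma> ` range i = range i}"
      using poisson_hom_comp[of E E \<gamma>' E \<gamma>] by (simp add: bij_comp)
  qed auto
  then show ?thesis
    unfolding Aut_V_def by (rule G.subgroup_imp_group)
qed

text \<open>Describes \<open>tau\<close> by two commuting squares, with \<open>i\<close> and with
  \<open>p\<close>, in which neither \<open>the_inv i\<close> nor the section occurs.\<close>

lemma tau_eqI:
  assumes "\<And>v. i (\<beta> v) = \<gamma> (i v)" "\<And>e. \<alpha> (p e) = p (\<gamma> e)"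
  shows "tau i p s \<gamma> = (\<beta>, \<alpha>)"
proof -
  have "the_inv i (\<gamma> (i v)) = \<beta> v" for v
    using assms(1)[of v, symmetric] inj_i by (simp add: the_inv_f_f)
  then show ?thesis
    using assms(2)[of "s x" for x] by (simp add: tau_def fun_eq_iff)
qed

text \<open>The square with \<open>p\<close> holds at every \<open>e\<close>, not only at values of
  \<open>s\<close>: the \<open>V\<close>-component of \<open>e\<close> stays in \<open>V\<close>
  under \<open>\<gamma>\<close> and is killed by \<open>p\<close>. Hence the induced map on
  \<open>P\<close> does not depend on the section.\<close>

lemma tauD:
  assumes "\<gamma> \<in> carrier (Aut_V E i)" "tau i p s \<gamma> = (\<beta>, \<alpha>)"
  shows "i (\<beta> v) = \<gamma> (i v)" "\<alpha> (p e) = p (\<gamma> e)"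
proof -
  have "\<gamma> (i v) \<in> range i" for v
    using assms(1) by (auto simp: carrier_Aut_V)
  then have *: "p (\<gamma> (i v)) = 0" for v
    using exact by blast
  then show "i (\<beta> v) = \<gamma> (i v)"
    using assms(2) i_the_inv by (auto simp: tau_def)
  have lin: "Vector_Spaces.linear (smul E) (smul E) \<gamma>"
    using assms(1) by (simp add: carrier_Aut_V poisson_hom_def)
  obtain w where e: "e = i w + s (p e)" by (rule decompose)
  have "p (\<gamma> e) = p (\<gamma> (s (p e)))"
    by (subst e) (simp add: linear_rules[OF lin] p_rules *)
  then show "\<alpha> (p e) = p (\<gamma> e)"
    using assms(2) by (auto simp: tau_def)
qed

lemma tau_compatible:
  assumes \<gamma>: "\<gamma> \<in> carrier (Aut_V E i)"
  shows "tau i p s \<gamma> \<in> carrier (compatible_pairs P sV \<mu> \<rho>)"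
proof -
  obtain \<beta> \<alpha> where tau: "tau i p s \<gamma> = (\<beta>, \<alpha>)" by (cases "tau i p s \<gamma>")
  note \<beta> = tauD(1)[OF \<gamma> tau] and \<alpha> = tauD(2)[OF \<gamma> tau]
  have hom: "poisson_hom E E \<gamma>" and lin: "Vector_Spaces.linear (smul E) (smul E) \<gamma>"
    and bij: "bij \<gamma>" and range: "\<gamma> ` range i = range i"
    using \<gamma> by (simp_all add: carrier_Aut_V poisson_hom_def)
  note \<gamma>_rules = linear_rules[OF lin]
  have hom': "\<gamma> (a \<bullet>\<^bsub>E\<^esub> b) = \<gamma> a \<bullet>\<^bsub>E\<^esub> \<gamma> b" "\<gamma> \<lbrace>a, b\<rbrace>\<^bsub>E\<^esub> = \<lbrace>\<gamma> a, \<gamma> b\<rbrace>\<^bsub>E\<^esub>" for a b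
    using hom by (simp_all add: poisson_hom_def)
  have \<alpha>': "\<alpha> x = p (\<gamma> (s x))" for x
    using \<alpha>[of "s x"] by simp
  have "Vector_Spaces.linear sV sV \<beta>"
    unfolding Vector_Spaces.linear_iff i_eq_iff[symmetric]
    by (simp add: vector_space i_rules \<beta> \<gamma>_rules)
  moreover have "inj \<beta>"
  proof (rule injI)
    fix v w assume "\<beta> v = \<beta> w"
    then have "\<gamma> (i v) = \<gamma> (i w)" by (metis \<beta>)
    then show "v = w" using bij by (simp add: bij_is_inj inj_eq)
  qed
  moreover have "surj \<beta>"
    unfolding surj_def
  proof
    fix v
    have "i v \<in> \<gamma> ` range i" using range by blast
    then obtain w where "i v = \<gamma> (i w)" by blast
    then have "v = \<beta> w" by (metis \<beta> i_eq_iff)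
    then show "\<exists>w. v = \<beta> w" ..
  qed
  moreover have "\<alpha> (x \<bullet> y) = \<alpha> x \<bullet> \<alpha> y" "\<alpha> \<lbrace>x, y\<rbrace> = \<lbrace>\<alpha> x, \<alpha> y\<rbrace>" for x y
    using \<alpha>[of "s x \<bullet>\<^bsub>E\<^esub> s y"] \<alpha>[of "\<lbrace>s x, s y\<rbrace>\<^bsub>E\<^esub>"]
    by (simp_all add: p_prd p_brk hom' \<alpha>')
  moreover have "Vector_Spaces.linear (smul P) (smul P) \<alpha>"
    unfolding Vector_Spaces.linear_iff
    by (simp add: vector_space_P \<alpha>' s_rules \<gamma>_rules p_rules)
  moreover have "inj \<alpha>"
  proof (rule injI)
    fix x y assume "\<alpha> x = \<alpha> y"
    then have "p (\<gamma> (s x - s y)) = 0" by (simp add: \<alpha>' \<gamma>_rules p_rules)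
    \<comment> \<open>An element of the kernel of \<open>p\<close> lies in \<open>range i\<close>,
      which is its own image under \<open>\<gamma>\<close>; injectivity of \<open>\<gamma>\<close>
      then puts \<open>s x - s y\<close> in \<open>range i\<close>.\<close>
    then have "\<gamma> (s x - s y) \<in> \<gamma> ` range i" using exact range by blast
    then have "s x - s y \<in> range i" using bij by (simp add: bij_is_inj inj_image_mem_iff)
    then have "p (s x - s y) = 0" using exact by blast
    then show "x = y" by (simp add: p_rules)
  qed
  moreover have "surj \<alpha>"
  proof (rule surjI)
    fix x
    show "\<alpha> (p (the_inv \<gamma> (s x))) = x"
      using bij by (simp add: \<alpha> the_inv_rules)
  qed
  \<comment> \<open>\<open>\<gamma> (s x)\<close> need not be a value of \<open>s\<close>, but it
    lies over \<open>\<alpha> x\<close>, which is all that \<open>prd_i\<close> and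
    \<open>brk_i\<close> require.\<close>
  moreover have "i (\<beta> (\<mu> x v)) = i (\<mu> (\<alpha> x) (\<beta> v))" "i (\<beta> (\<rho> x v)) = i (\<rho> (\<alpha> x) (\<beta> v))" for x v
    using prd_i[of "\<gamma> (s x)" "\<beta> v"] brk_i[of "\<gamma> (s x)" "\<beta> v"]
    by (simp_all only: \<beta> i_\<mu>[of x] i_\<rho>[of x] hom' \<alpha>')
  ultimately show ?thesis
    by (simp add: tau carrier_compatible_pairs poisson_hom_def bij_def)
qed

lemma group_hom_tau: "group_hom (Aut_V E i) (compatible_pairs P sV \<mu> \<rho>) (tau i p s)"
proof -
  have "tau i p s (\<gamma> \<otimes>\<^bsub>Aut_V E i\<^esub> \<gamma>') =
      tau i p s \<gamma> \<otimes>\<^bsub>compatible_pairs P sV \<mu> \<rho>\<^esub> tau i p s \<gamma>'"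
    if c: "\<gamma> \<in> carrier (Aut_V E i)" "\<gamma>' \<in> carrier (Aut_V E i)" for \<gamma> \<gamma>'
  proof -
    obtain \<beta> \<alpha> \<beta>' \<alpha>' where tau: "tau i p s \<gamma> = (\<beta>, \<alpha>)" "tau i p s \<gamma>' = (\<beta>', \<alpha>')"
      by (cases "tau i p s \<gamma>", cases "tau i p s \<gamma>'")
    \<comment> \<open>Commuting squares compose.\<close>
    have "tau i p s (\<gamma> \<circ> \<gamma>') = (\<beta> \<circ> \<beta>', \<alpha> \<circ> \<alpha>')"
      using tauD[OF c(1) tau(1)] tauD[OF c(2) tau(2)] by (intro tau_eqI) simp_all
    then show ?thesis
      by (simp add: tau Aut_V_def compatible_pairs_def)
  qed
  then show ?thesis
    by (intro group_hom.intro group_hom_axioms.intro homI group_Aut_V group_compatible_pairs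
        tau_compatible)
qed

text \<open>The unit of the group of compatible pairs is \<open>(id, id)\<close>. Exactness at
  \<open>Aut_V E i\<close> follows at once.\<close>

lemma Aut_VP_eq:
  "Aut_VP E i p s =
    (Aut_V E i)\<lparr>carrier := kernel (Aut_V E i) (compatible_pairs P sV \<mu> \<rho>) (tau i p s)\<rparr>"
  by (simp add: Aut_VP_def kernel_def compatible_pairs_def)

section \<open>The Wells map\<close>

lemma wells_cocycle:
  assumes "g \<in> carrier (compatible_pairs P sV \<mu> \<rho>)"
  shows "twist g (h, H) - (h, H) \<in> cocycles2 P sV \<mu> \<rho>"
  using assms by (intro diff_cocycle twist_cocycle section_cocycle)

lemma wells_in_H2:
  assumes "g \<in> carrier (compatible_pairs P sV \<mu> \<rho>)"
  shows "wells P sV \<mu> \<rho> E i s g \<in> carrier (H2_FGV P sV \<mu> \<rho>)"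
  using wells_cocycle[OF assms]
  by (simp add: wells_def section_cocycle_eq H2_FGV_def cohom_class_def quotientI)

text \<open>The zero of the cohomology is the class of the zero cocycle, so vanishing means that the
  difference of cocycles is a coboundary. Substituting \<open>\<alpha> x\<close>,
  \<open>\<alpha> y\<close> for the arguments removes the inverse of \<open>\<alpha>\<close> and
  gives the form that computations in \<open>E\<close> produce.\<close>

lemma wells_eq_zero_iff:
  assumes g: "(\<beta>, \<alpha>) \<in> carrier (compatible_pairs P sV \<mu> \<rho>)"
  shows "wells P sV \<mu> \<rho> E i s (\<beta>, \<alpha>) = \<zero>\<^bsub>H2_FGV P sV \<mu> \<rho>\<^esub> \<longleftrightarrow>
    (\<exists>\<phi>. Vector_Spaces.linear (smul P) sV \<phi> \<and>
      (\<forall>x y. \<beta> (h x y) - h (\<alpha> x) (\<alpha> y) =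
         \<mu> (\<alpha> x) (\<phi> (\<alpha> y)) - \<phi> (\<alpha> (x \<bullet> y)) + \<mu> (\<alpha> y) (\<phi> (\<alpha> x))) \<and>
      (\<forall>x y. \<beta> (H x y) - H (\<alpha> x) (\<alpha> y) =
         \<rho> (\<alpha> x) (\<phi> (\<alpha> y)) - \<phi> (\<alpha> \<lbrace>x, y\<rbrace>) - \<rho> (\<alpha> y) (\<phi> (\<alpha> x))))"
    (is "_ \<longleftrightarrow> ?R")
proof -
  have bij: "bij \<alpha>" and hom: "\<alpha> (x \<bullet> y) = \<alpha> x \<bullet> \<alpha> y" "\<alpha> \<lbrace>x, y\<rbrace> = \<lbrace>\<alpha> x, \<alpha> y\<rbrace>" for x y
    using g by (auto simp: carrier_compatible_pairs poisson_hom_def)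
  have reindex: "(\<forall>x y. Q x y) \<longleftrightarrow> (\<forall>x y. Q (\<alpha> x) (\<alpha> y))" for Q
    using bij by (metis bij_pointE)
  have "wells P sV \<mu> \<rho> E i s (\<beta>, \<alpha>) = \<zero>\<^bsub>H2_FGV P sV \<mu> \<rho>\<^esub> \<longleftrightarrow>
      (twist (\<beta>, \<alpha>) (h, H) - (h, H), 0) \<in> cohomologous P sV \<mu> \<rho>"
    using cohom_class_eq_iff[OF equiv_cohomologous wells_cocycle[OF g] zero_cocycle]
    by (simp add: wells_def section_cocycle_eq H2_FGV_def)
  also have "\<dots> \<longleftrightarrow> (\<exists>\<phi>. Vector_Spaces.linear (smul P) sV \<phi> \<and>
      (\<forall>x y. \<beta> (h (the_inv \<alpha> x) (the_inv \<alpha> y)) - h x y = \<mu> x (\<phi> y) - \<phi> (x \<bullet> y) + \<mu> y (\<phi> x)) \<and>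
      (\<forall>x y. \<beta> (H (the_inv \<alpha> x) (the_inv \<alpha> y)) - H x y = \<rho> x (\<phi> y) - \<phi> \<lbrace>x, y\<rbrace> - \<rho> y (\<phi> x)))"
    using wells_cocycle[OF g] zero_cocycle
    by (simp add: cohomologous_def twist_def zero_prod_def)
  also have "\<dots> \<longleftrightarrow> ?R"
    \<comment> \<open>Fixing the left-hand sides confines the substitution to these two conditions
      and keeps it from applying again to its own result; the placeholder matches the right-hand
      sides, which involve the bound \<open>\<phi>\<close>.\<close>
    unfolding reindex[where Q = "\<lambda>x y. \<beta> (h (the_inv \<alpha> x) (the_inv \<alpha> y)) - h x y = _ x y"]
      reindex[where Q = "\<lambda>x y. \<beta> (H (the_inv \<alpha> x) (the_inv \<alpha> y)) - H x y = _ x y"]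
    by (simp add: hom the_inv_rules[OF bij])
  finally show ?thesis .
qed

section \<open>Coordinates on \<open>E\<close> and lifting of compatible pairs\<close>

lemma s_prd_s: "s x \<bullet>\<^bsub>E\<^esub> s y = i (h x y) + s (x \<bullet> y)"
  and s_brk_s: "\<lbrace>s x, s y\<rbrace>\<^bsub>E\<^esub> = i (H x y) + s \<lbrace>x, y\<rbrace>"
  by (simp_all add: i_h i_H)

lemma decomposed_prd:
  "(i v + s x) \<bullet>\<^bsub>E\<^esub> (i w + s y) = i (\<mu> x w + \<mu> y v + h x y) + s (x \<bullet> y)"
  by (simp add: E_rules i_rules i_prd_i i_\<mu> s_prd_s E.prd_commute[of "i v" "s y"])

text \<open>The minus sign comes from skew-symmetry: \<open>\<rho>\<close> acts with the element of
  \<open>V\<close> in the second slot of the bracket.\<close>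

lemma decomposed_brk:
  "\<lbrace>i v + s x, i w + s y\<rbrace>\<^bsub>E\<^esub> = i (\<rho> x w - \<rho> y v + H x y) + s \<lbrace>x, y\<rbrace>"
  by (simp add: E_rules i_rules i_brk_i i_\<rho> s_brk_s E.brk_skew[of "i v" "s y"])

text \<open>Applying \<open>p\<close> recovers the second component. With \<open>decompose\<close>,
  this makes \<open>E\<close> the direct sum of \<open>V\<close> and the image of \<open>s\<close>,
  so equations in \<open>E\<close> split into components.\<close>

lemma decomposed_eq_iff: "i v + s x = i w + s y \<longleftrightarrow> v = w \<and> x = y"
proof
  assume eq: "i v + s x = i w + s y"
  from arg_cong[where f = p, OF eq] have "x = y" by (simp add: p_rules)
  with eq show "v = w \<and> x = y" by simp
qed simp

lemma wells_tau:
  assumes \<gamma>: "\<gamma> \<in> carrier (Aut_V E i)"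
  shows "wells P sV \<mu> \<rho> E i s (tau i p s \<gamma>) = \<zero>\<^bsub>H2_FGV P sV \<mu> \<rho>\<^esub>"
proof -
  obtain \<beta> \<alpha> where tau: "tau i p s \<gamma> = (\<beta>, \<alpha>)" by (cases "tau i p s \<gamma>")
  note \<beta> = tauD(1)[OF \<gamma> tau] and \<alpha> = tauD(2)[OF \<gamma> tau]
  have g: "(\<beta>, \<alpha>) \<in> carrier (compatible_pairs P sV \<mu> \<rho>)"
    using tau_compatible[OF \<gamma>] by (simp add: tau)
  then have \<alpha>_bij: "bij \<alpha>" and \<alpha>_lin: "Vector_Spaces.linear (smul P) (smul P) \<alpha>"
    by (auto simp: carrier_compatible_pairs poisson_hom_def)
  have lin: "Vector_Spaces.linear (smul E) (smul E) \<gamma>"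
    and hom: "\<gamma> (a \<bullet>\<^bsub>E\<^esub> b) = \<gamma> a \<bullet>\<^bsub>E\<^esub> \<gamma> b" "\<gamma> \<lbrace>a, b\<rbrace>\<^bsub>E\<^esub> = \<lbrace>\<gamma> a, \<gamma> b\<rbrace>\<^bsub>E\<^esub>" for a b
    using \<gamma> by (auto simp: carrier_Aut_V poisson_hom_def)
  define \<psi> where "\<psi> x = the_inv i (\<gamma> (s x) - s (\<alpha> x))" for x
  have i_\<psi>: "i (\<psi> x) = \<gamma> (s x) - s (\<alpha> x)" for x
    using \<alpha>[of "s x"] by (simp add: \<psi>_def i_the_inv p_rules)
  interpret E: vector_space "smul E" by (rule E.vector_space)
  have "Vector_Spaces.linear (smul P) sV \<psi>"
    unfolding Vector_Spaces.linear_iff i_eq_iff[symmetric]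
    by (simp add: vector_space_P vector_space i_rules i_\<psi> linear_rules[OF lin] s_rules
        linear_rules[OF \<alpha>_lin] E.scale_right_diff_distrib)
  \<comment> \<open>The criterion evaluates its linear map at \<open>\<alpha> x\<close>, so
    \<open>\<psi>\<close> is precomposed with the inverse of \<open>\<alpha>\<close>.\<close>
  then have \<phi>: "Vector_Spaces.linear (smul P) sV (\<lambda>x. \<psi> (the_inv \<alpha> x))"
    using linear_compose[OF linear_the_inv[OF \<alpha>_lin \<alpha>_bij]] by blast
  have \<gamma>_s: "\<gamma> (s x) = i (\<psi> x) + s (\<alpha> x)" for x
    by (simp add: i_\<psi>)
  have \<gamma>_dec: "\<gamma> (i v + s x) = i (\<beta> v + \<psi> x) + s (\<alpha> x)" for v x
    by (simp add: linear_rules[OF lin] \<gamma>_s \<beta>[symmetric] i_rules)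
  have "\<beta> (h x y) - h (\<alpha> x) (\<alpha> y) = \<mu> (\<alpha> x) (\<psi> y) - \<psi> (x \<bullet> y) + \<mu> (\<alpha> y) (\<psi> x)" for x y
    using hom(1)[of "s x" "s y"] unfolding s_prd_s \<gamma>_dec \<gamma>_s decomposed_prd decomposed_eq_iff
    by (simp add: algebra_simps)
  moreover have "\<beta> (H x y) - H (\<alpha> x) (\<alpha> y) = \<rho> (\<alpha> x) (\<psi> y) - \<psi> \<lbrace>x, y\<rbrace> - \<rho> (\<alpha> y) (\<psi> x)" for x y
    using hom(2)[of "s x" "s y"] unfolding s_brk_s \<gamma>_dec \<gamma>_s decomposed_brk decomposed_eq_iff
    by (simp add: algebra_simps)
  ultimately show ?thesis
    unfolding tau wells_eq_zero_iff[OF g] using \<phi> the_inv_rules(1)[OF \<alpha>_bij]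
    by (intro exI[of _ "\<lambda>x. \<psi> (the_inv \<alpha> x)"]) simp
qed

text \<open>A linear map \<open>\<phi>\<close> that trivializes the difference of cocycles corrects
  the naive lift acting by \<open>\<beta>\<close> and \<open>\<alpha>\<close> on components. The
  coboundary equations and compatibility match the \<open>V\<close>-components of products and
  brackets.\<close>

lemma lift_of_wells_zero:
  assumes g: "(\<beta>, \<alpha>) \<in> carrier (compatible_pairs P sV \<mu> \<rho>)"
    and zero: "wells P sV \<mu> \<rho> E i s (\<beta>, \<alpha>) = \<zero>\<^bsub>H2_FGV P sV \<mu> \<rho>\<^esub>"
  shows "\<exists>\<gamma>\<in>carrier (Aut_V E i). tau i p s \<gamma> = (\<beta>, \<alpha>)"
proof -
  from g have \<beta>: "bij \<beta>" "Vector_Spaces.linear sV sV \<beta>"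
    and \<alpha>: "bij \<alpha>" "Vector_Spaces.linear (smul P) (smul P) \<alpha>"
    and \<alpha>_hom: "\<alpha> (x \<bullet> y) = \<alpha> x \<bullet> \<alpha> y" "\<alpha> \<lbrace>x, y\<rbrace> = \<lbrace>\<alpha> x, \<alpha> y\<rbrace>"
    and compat: "\<beta> (\<mu> x v) = \<mu> (\<alpha> x) (\<beta> v)" "\<beta> (\<rho> x v) = \<rho> (\<alpha> x) (\<beta> v)" for x y v
    by (auto simp: carrier_compatible_pairs poisson_hom_def)
  from zero obtain \<phi> where \<phi>: "Vector_Spaces.linear (smul P) sV \<phi>"
    and h: "\<beta> (h x y) - h (\<alpha> x) (\<alpha> y) =
      \<mu> (\<alpha> x) (\<phi> (\<alpha> y)) - \<phi> (\<alpha> (x \<bullet> y)) + \<mu> (\<alpha> y) (\<phi> (\<alpha> x))"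
    and H: "\<beta> (H x y) - H (\<alpha> x) (\<alpha> y) =
      \<rho> (\<alpha> x) (\<phi> (\<alpha> y)) - \<phi> (\<alpha> \<lbrace>x, y\<rbrace>) - \<rho> (\<alpha> y) (\<phi> (\<alpha> x))" for x y
    unfolding wells_eq_zero_iff[OF g] by auto
  note lin = linear_rules[OF \<beta>(2)] linear_rules[OF \<alpha>(2)] linear_rules[OF \<phi>]
  interpret E: vector_space "smul E" by (rule E.vector_space)
  interpret V: vector_space sV by (rule vector_space)
  \<comment> \<open>The components of \<open>e\<close> are \<open>the_inv i (e - s (p e))\<close>
    and \<open>p e\<close>; in them \<open>\<gamma>\<close> is triangular, with diagonal entries
    \<open>\<beta>\<close> and \<open>\<alpha>\<close>.\<close>
  define \<gamma> where "\<gamma> e =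
    i (\<beta> (the_inv i (e - s (p e))) + \<phi> (\<alpha> (p e))) + s (\<alpha> (p e))" for e
  have \<gamma>_dec: "\<gamma> (i v + s x) = i (\<beta> v + \<phi> (\<alpha> x)) + s (\<alpha> x)" for v x
    using inj_i by (simp add: \<gamma>_def p_rules the_inv_f_f)
  have add: "(i v + s x) + (i w + s y) = i (v + w) + s (x + y)"
    and scale: "smul E a (i v + s x) = i (sV a v) + s (smul P a x)" for v w x y a
    by (simp_all add: i_rules s_rules E.scale_right_distrib)
  have \<gamma>_hom: "\<gamma> (a + b) = \<gamma> a + \<gamma> b" "\<gamma> (smul E k a) = smul E k (\<gamma> a)"
    "\<gamma> (a \<bullet>\<^bsub>E\<^esub> b) = \<gamma> a \<bullet>\<^bsub>E\<^esub> \<gamma> b" "\<gamma> \<lbrace>a, b\<rbrace>\<^bsub>E\<^esub> = \<lbrace>\<gamma> a, \<gamma> b\<rbrace>\<^bsub>E\<^esub>" for a b k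
  proof -
    obtain v x where a: "a = i v + s x" by (rule decompose)
    obtain w y where b: "b = i w + s y" by (rule decompose)
    show "\<gamma> (a + b) = \<gamma> a + \<gamma> b" "\<gamma> (smul E k a) = smul E k (\<gamma> a)"
      unfolding a b add scale \<gamma>_dec
      by (simp_all add: lin decomposed_eq_iff V.scale_right_distrib algebra_simps)
    \<comment> \<open>Solved for \<open>\<beta> (h x y)\<close>, which occurs when
      \<open>\<gamma>\<close> is applied to the product \<open>decomposed_prd\<close>.\<close>
    have "\<beta> (h x y) = h (\<alpha> x) (\<alpha> y)
      + (\<mu> (\<alpha> x) (\<phi> (\<alpha> y)) - \<phi> (\<alpha> (x \<bullet> y)) + \<mu> (\<alpha> y) (\<phi> (\<alpha> x)))"
      using h[of x y] by (simp add: diff_eq_eq add.commute)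
    then show "\<gamma> (a \<bullet>\<^bsub>E\<^esub> b) = \<gamma> a \<bullet>\<^bsub>E\<^esub> \<gamma> b"
      unfolding a b decomposed_prd \<gamma>_dec
      by (simp add: lin decomposed_eq_iff compat action_rules \<alpha>_hom algebra_simps)
    have "\<beta> (H x y) = H (\<alpha> x) (\<alpha> y)
      + (\<rho> (\<alpha> x) (\<phi> (\<alpha> y)) - \<phi> (\<alpha> \<lbrace>x, y\<rbrace>) - \<rho> (\<alpha> y) (\<phi> (\<alpha> x)))"
      using H[of x y] by (simp add: diff_eq_eq add.commute)
    then show "\<gamma> \<lbrace>a, b\<rbrace>\<^bsub>E\<^esub> = \<lbrace>\<gamma> a, \<gamma> b\<rbrace>\<^bsub>E\<^esub>"
      unfolding a b decomposed_brk \<gamma>_dec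
      by (simp add: lin decomposed_eq_iff compat action_rules \<alpha>_hom algebra_simps)
  qed
  have "inj \<gamma>"
  proof (rule injI)
    fix a b assume eq: "\<gamma> a = \<gamma> b"
    obtain v x where a: "a = i v + s x" by (rule decompose)
    obtain w y where b: "b = i w + s y" by (rule decompose)
    from eq have *: "\<beta> v + \<phi> (\<alpha> x) = \<beta> w + \<phi> (\<alpha> y) \<and> \<alpha> x = \<alpha> y"
      unfolding a b \<gamma>_dec decomposed_eq_iff .
    then have "\<beta> v = \<beta> w" by (metis add_right_cancel)
    with * have "x = y" "v = w"
      using \<alpha>(1) \<beta>(1) by (simp_all add: bij_is_inj inj_eq)
    then show "a = b" by (simp add: a b)
  qed
  moreover have "surj \<gamma>"
    unfolding surj_def
  proof
    fix e
    obtain v x where e: "e = i v + s x" by (rule decompose)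
    \<comment> \<open>Inverts the triangular map: \<open>\<alpha>\<close> is undone first, then its
      contribution \<open>\<phi> x\<close> is subtracted before \<open>\<beta>\<close> is
      undone.\<close>
    have "e = \<gamma> (i (the_inv \<beta> (v - \<phi> x)) + s (the_inv \<alpha> x))"
      unfolding e \<gamma>_dec by (simp add: the_inv_rules \<alpha>(1) \<beta>(1))
    then show "\<exists>a. e = \<gamma> a" ..
  qed
  moreover have \<gamma>_i: "\<gamma> (i v) = i (\<beta> v)" for v
    using \<gamma>_dec[of v 0] by (simp add: s_rules lin)
  \<comment> \<open>Surjectivity of \<open>\<beta>\<close> will turn this into
    \<open>range i\<close>.\<close>
  moreover have "\<gamma> ` range i = i ` range \<beta>"
    by (simp add: image_image \<gamma>_i)
  ultimately have "\<gamma> \<in> carrier (Aut_V E i)"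
    using \<beta>(1)
    by (simp add: carrier_Aut_V poisson_hom_def Vector_Spaces.linear_iff \<gamma>_hom E.vector_space
        bij_def bij_is_surj)
  moreover have "\<alpha> (p e) = p (\<gamma> e)" for e
  proof -
    obtain v x where e: "e = i v + s x" by (rule decompose)
    show ?thesis unfolding e \<gamma>_dec by (simp add: p_rules)
  qed
  then have "tau i p s \<gamma> = (\<beta>, \<alpha>)"
    by (intro tau_eqI) (simp_all add: \<gamma>_i)
  ultimately show ?thesis by blast
qed

section \<open>Exactness of the sequence\<close>

lemma image_tau:
  "tau i p s ` carrier (Aut_V E i) =
    {g \<in> carrier (compatible_pairs P sV \<mu> \<rho>). wells P sV \<mu> \<rho> E i s g = \<zero>\<^bsub>H2_FGV P sV \<mu> \<rho>\<^esub>}"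
proof (intro equalityI subsetI)
  fix g assume "g \<in> {g \<in> carrier (compatible_pairs P sV \<mu> \<rho>).
    wells P sV \<mu> \<rho> E i s g = \<zero>\<^bsub>H2_FGV P sV \<mu> \<rho>\<^esub>}"
  then show "g \<in> tau i p s ` carrier (Aut_V E i)"
    by (cases g) (force dest: lift_of_wells_zero)
qed (auto simp: tau_compatible wells_tau)

lemma group_hom_inclusion: "group_hom (Aut_VP E i p s) (Aut_V E i) id"
proof -
  interpret tau: group_hom "Aut_V E i" "compatible_pairs P sV \<mu> \<rho>" "tau i p s"
    by (rule group_hom_tau)
  have "group (Aut_VP E i p s)"
    \<comment> \<open>A kernel is a subgroup.\<close>
    unfolding Aut_VP_eq by (rule tau.G.subgroup_imp_group[OF tau.subgroup_kernel])
  then show ?thesis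
    by (intro group_hom.intro group_hom_axioms.intro homI tau.G.is_group)
      (auto simp: Aut_VP_def)
qed

end

theorem theorem3p4:
  fixes P :: "('k::field_char_0, 'p::ab_group_add) poisson"
    and sV :: "'k \<Rightarrow> 'v::ab_group_add \<Rightarrow> 'v"
    and \<mu> \<rho> :: "'p \<Rightarrow> 'v \<Rightarrow> 'v"
    and E :: "('k, 'e::ab_group_add) poisson"
    and i :: "'v \<Rightarrow> 'e" and p :: "'e \<Rightarrow> 'p" and s :: "'p \<Rightarrow> 'e"
  assumes "poisson_algebra P"
    and "poisson_representation P sV \<mu> \<rho>"
    and "abelian_extension P sV \<mu> \<rho> E i p"
    and "linear_section P E p s"
  shows "group_hom (Aut_VP E i p s) (Aut_V E i) id \<and>
    group_hom (Aut_V E i) (compatible_pairs P sV \<mu> \<rho>) (tau i p s) \<and>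
    wells P sV \<mu> \<rho> E i s \<in> carrier (compatible_pairs P sV \<mu> \<rho>) \<rightarrow> carrier (H2_FGV P sV \<mu> \<rho>) \<and>
    kernel (Aut_VP E i p s) (Aut_V E i) id = {\<one>\<^bsub>Aut_VP E i p s\<^esub>} \<and>
    id ` carrier (Aut_VP E i p s) = kernel (Aut_V E i) (compatible_pairs P sV \<mu> \<rho>) (tau i p s) \<and>
    tau i p s ` carrier (Aut_V E i) =
      {g \<in> carrier (compatible_pairs P sV \<mu> \<rho>).
         wells P sV \<mu> \<rho> E i s g = \<zero>\<^bsub>H2_FGV P sV \<mu> \<rho>\<^esub>}"
proof -
  interpret sectioned_extension P sV \<mu> \<rho> E i p s
    using assms
    by (intro sectioned_extension.intro sectioned_extension_axioms.intro)
  \<comment> \<open>Only the identity maps to the unit; that it lies in the carrier comes from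
    \<open>Aut_VP E i p s\<close> being a group.\<close>
  have "kernel (Aut_VP E i p s) (Aut_V E i) id = {\<one>\<^bsub>Aut_VP E i p s\<^esub>}"
    using group.is_monoid[OF group_hom.axioms(1)[OF group_hom_inclusion]]
    by (auto simp: kernel_def Aut_VP_def dest: monoid.one_closed)
  moreover have "id ` carrier (Aut_VP E i p s) =
      kernel (Aut_V E i) (compatible_pairs P sV \<mu> \<rho>) (tau i p s)"
    by (simp add: Aut_VP_eq)
  ultimately show ?thesis
    using group_hom_inclusion group_hom_tau wells_in_H2 image_tau by simp
qed

end
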